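(* Let $S=(S_t)_{t\ge0}$ be a subordinator whose Laplace exponent $\phi$ satisfies (L) with constants $\gamma,\lambda_L,C_L$ and (U) with constants $\delta,\lambda_U,C_U$ where $\delta<1$, and let $X=(X_t)_{t\ge0}$ be the corresponding subordinate Brownian motion in $\mathbb{R}^d$ ($d\ge1$) with transition density $p(t,x,y)=p(t,y-x)$. Then there exist constants $\kappa,\eta,\theta\in(0,1)$ such that for all $0<t<\kappa\phi(\lambda_L)^{-1}$ and $x\in\mathbb{R}^d$ satisfying $|x|<\theta\lambda_L^{-1/2}\wedge\eta\lambda_U^{-1/2}$, $$p(t,x)\asymp \phi^{-1}(t^{-1})^{d/2}\wedge t|x|^{-d}\phi(|x|^{-2}).$$
   Context: A subordinator $S=(S_t)_{t\ge0}$ is an increasing Lévy process with values in $[0,\infty)$, started at $0$. Its Laplace exponent $\phi$ is defined by $\mathbb{E}e^{-\lambda S_t}=e^{-t\phi(\lambda)}$, $\lambda>0$, and $\phi(\lambda)=b\lambda+\int_{(0,\infty)}(1-e^{-\lambda s})\mu(ds)$, where $b\ge0$ is the drift and $\mu$ is the Lévy measure, a measure on $(0,\infty)$ with $\int_{(0,\infty)}(1\wedge s)\mu(ds)<\infty$. The corresponding subordinate Brownian motion is $X_t=B_{S_t}$, where $B$ is a Brownian motion in $\mathbb{R}^d$ independent of $S$, normalized so that $\mathbb{E}e^{i\xi\cdot B_t}=e^{-t|\xi|^2}$; its transition density is $p(t,x)=\int_{(0,\infty)}(4\pi s)^{-d/2}e^{-|x|^2/(4s)}\,\mathbb{P}(S_t\in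 ds)$. Scaling conditions for $f:(0,\infty)\to(0,\infty)$. (L): there exist $\gamma>0$, $\lambda_L\ge0$, $C_L>0$ such that $f(\lambda x)/f(\lambda)\ge C_Lx^\gamma$ for all $\lambda>\lambda_L$, $x\ge1$. (U): there exist $\delta>0$, $\lambda_U\ge0$, $C_U>0$ such that $f(\lambda x)/f(\lambda)\le C_Ux^\delta$ for all $\lambda>\lambda_U$, $x\ge1$. $\phi^{-1}$ is the inverse function of $\phi$; $a\wedge b=\min\{a,b\}$. $f\asymp g$ on a set means there are constants $c_1,c_2>0$ with $c_1f\le g\le c_2f$ on that set (constants not depending on $t,x$). Conventions: $\phi(0)=0$, $0^{-1}=+\infty$ (so $0^{-1/2}=+\infty$, and for $x=0$ the quantity $t|x|^{-d}\phi(|x|^{-2})$ is $+\infty$). *)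

theory Defs
  imports "HOL-Probability.Probability"
begin

text \<open>
  Processes are functions of type \<open>real \<Rightarrow> 'w \<Rightarrow> 'a\<close>; only the values at times \<open>t \<ge> 0\<close> matter.
  Path properties are required almost surely.
\<close>

definition cadlag :: "(real \<Rightarrow> 'a::topological_space) \<Rightarrow> bool" where
  "cadlag f \<longleftrightarrow>
     (\<forall>t\<ge>0. (f \<longlongrightarrow> f t) (at_right t)) \<and> (\<forall>t>0. \<exists>l. (f \<longlongrightarrow> l) (at_left t))"

definition levy_process :: "'w measure \<Rightarrow> (real \<Rightarrow> 'w \<Rightarrow> 'a::euclidean_space) \<Rightarrow> bool" where
  "levy_process M X \<longleftrightarrow>
     prob_space M \<and>
     (\<forall>t\<ge>0. X t \<in> borel_measurable M) \<and>
     (AE \<omega> in M. X 0 \<omega> = 0) \<and>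
     (\<forall>(\<tau> :: nat \<Rightarrow> real) n. 0 \<le> \<tau> 0 \<and> (\<forall>i<n. \<tau> i \<le> \<tau> (Suc i)) \<longrightarrow>
        prob_space.indep_vars M (\<lambda>_. borel) (\<lambda>i \<omega>. X (\<tau> (Suc i)) \<omega> - X (\<tau> i) \<omega>) {..<n}) \<and>
     (\<forall>s\<ge>0. \<forall>t\<ge>0. distr M borel (\<lambda>\<omega>. X (s + t) \<omega> - X s \<omega>) = distr M borel (X t)) \<and>
     (AE \<omega> in M. cadlag (\<lambda>t. X t \<omega>))"

definition subordinator :: "'w measure \<Rightarrow> (real \<Rightarrow> 'w \<Rightarrow> real) \<Rightarrow> bool" where
  "subordinator M S \<longleftrightarrow>
     levy_process M S \<and>
     (\<forall>t\<ge>0. \<forall>\<omega>\<in>space M. 0 \<le> S t \<omega>) \<and>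
     (AE \<omega> in M. \<forall>s t. 0 \<le> s \<and> s \<le> t \<longrightarrow> S s \<omega> \<le> S t \<omega>)"

definition levy_measure :: "real measure \<Rightarrow> bool" where
  "levy_measure \<mu> \<longleftrightarrow>
     sets \<mu> = sets (restrict_space borel {0<..}) \<and> (\<integral>\<^sup>+ s. ennreal (min 1 s) \<partial>\<mu>) < \<infinity>"

definition has_laplace_exponent ::
  "'w measure \<Rightarrow> (real \<Rightarrow> 'w \<Rightarrow> real) \<Rightarrow> (real \<Rightarrow> real) \<Rightarrow> real \<Rightarrow> real measure \<Rightarrow> bool" where
  "has_laplace_exponent M S \<phi> b \<mu> \<longleftrightarrow>
     0 \<le> b \<and> levy_measure \<mu> \<and> \<phi> 0 = 0 \<and>
     (\<forall>l>0. (\<forall>t\<ge>0. (\<integral>\<omega>. exp (- l * S t \<omega>) \<partial>M) = exp (- t * \<phi> l)) \<and>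
            \<phi> l = b * l + (\<integral>s. (1 - exp (- l * s)) \<partial>\<mu>))"

text \<open>The normalization below makes the variance of each coordinate at time \<open>t\<close> equal to \<open>2 * t\<close>.\<close>

definition brownian_motion :: "'w measure \<Rightarrow> (real \<Rightarrow> 'w \<Rightarrow> real ^ 'd) \<Rightarrow> bool" where
  "brownian_motion M B \<longleftrightarrow>
     levy_process M B \<and>
     (AE \<omega> in M. continuous_on {0..} (\<lambda>t. B t \<omega>)) \<and>
     (\<forall>t\<ge>0. \<forall>\<xi>. (\<integral>\<omega>. exp (\<i> * complex_of_real (\<xi> \<bullet> B t \<omega>)) \<partial>M)
                 = complex_of_real (exp (- t * (norm \<xi>)\<^sup>2)))"

text \<open>
  Independence of the generated sigma-algebras; \<open>indep_var\<close> would force both processes to have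
  the same value type.
\<close>

definition indep_processes ::
  "'w measure \<Rightarrow> (real \<Rightarrow> 'w \<Rightarrow> 'a::topological_space) \<Rightarrow>
    (real \<Rightarrow> 'w \<Rightarrow> 'b::topological_space) \<Rightarrow> bool" where
  "indep_processes M X Y \<longleftrightarrow>
     prob_space.indep_set M
       (sets (vimage_algebra (space M) (\<lambda>\<omega>. \<lambda>t\<in>{0..}. X t \<omega>) (Pi\<^sub>M {0..} (\<lambda>_. borel))))
       (sets (vimage_algebra (space M) (\<lambda>\<omega>. \<lambda>t\<in>{0..}. Y t \<omega>) (Pi\<^sub>M {0..} (\<lambda>_. borel))))"

definition subordinate_brownian_motion ::
  "'w measure \<Rightarrow> (real \<Rightarrow> 'w \<Rightarrow> real) \<Rightarrow> (real \<Rightarrow> 'w \<Rightarrow> real ^ 'd) \<Rightarrow> (real \<Rightarrow> 'w \<Rightarrow> real ^ 'd) \<Rightarrow> bool" where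
  "subordinate_brownian_motion M S B X \<longleftrightarrow>
     subordinator M S \<and> brownian_motion M B \<and> indep_processes M B S \<and>
     (\<forall>t\<ge>0. \<forall>\<omega>\<in>space M. X t \<omega> = B (S t \<omega>) \<omega>)"

text \<open>
  The transition density \<open>p t x\<close> of the subordinate Brownian motion, in the pointwise version given
  by integrating the Gaussian kernel against the law of \<open>S t\<close>. It is \<open>ennreal\<close>-valued, so that a
  divergent integral has the value \<open>\<infinity>\<close>.
\<close>

definition sbm_density ::
  "'w measure \<Rightarrow> (real \<Rightarrow> 'w \<Rightarrow> real) \<Rightarrow> real \<Rightarrow> real ^ 'd \<Rightarrow> ennreal" where
  "sbm_density M S t x =
     (\<integral>\<^sup>+ s\<in>{0<..}. ennreal ((4 * pi * s) powr (- real CARD('d) / 2) * exp (- (norm x)\<^sup>2 / (4 * s)))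
        \<partial>(distr M borel (S t)))"

definition lower_scaling :: "(real \<Rightarrow> real) \<Rightarrow> real \<Rightarrow> real \<Rightarrow> real \<Rightarrow> bool" where
  "lower_scaling f \<gamma> l\<^sub>L C\<^sub>L \<longleftrightarrow>
     (\<forall>l>0. 0 < f l) \<and> 0 < \<gamma> \<and> 0 \<le> l\<^sub>L \<and> 0 < C\<^sub>L \<and>
     (\<forall>l>l\<^sub>L. \<forall>x\<ge>1. f (l * x) / f l \<ge> C\<^sub>L * x powr \<gamma>)"

definition upper_scaling :: "(real \<Rightarrow> real) \<Rightarrow> real \<Rightarrow> real \<Rightarrow> real \<Rightarrow> bool" where
  "upper_scaling f \<delta> l\<^sub>U C\<^sub>U \<longleftrightarrow>
     (\<forall>l>0. 0 < f l) \<and> 0 < \<delta> \<and> 0 \<le> l\<^sub>U \<and> 0 < C\<^sub>U \<and>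
     (\<forall>l>l\<^sub>U. \<forall>x\<ge>1. f (l * x) / f l \<le> C\<^sub>U * x powr \<delta>)"

definition comparable_on :: "'a set \<Rightarrow> ('a \<Rightarrow> ennreal) \<Rightarrow> ('a \<Rightarrow> ennreal) \<Rightarrow> bool" where
  "comparable_on A f g \<longleftrightarrow>
     (\<exists>c\<^sub>1>0. \<exists>c\<^sub>2>0. \<forall>z\<in>A. ennreal c\<^sub>1 * f z \<le> g z \<and> g z \<le> ennreal c\<^sub>2 * f z)"

text \<open>The case distinction is needed because \<open>norm x powr a = 0\<close> for \<open>x = 0\<close>.\<close>

definition off_diagonal_bound :: "(real \<Rightarrow> real) \<Rightarrow> real \<Rightarrow> real ^ 'd \<Rightarrow> ennreal" where
  "off_diagonal_bound \<phi> t x =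
     (if x = 0 then \<infinity>
      else ennreal (t * norm x powr (- real CARD('d)) * \<phi> (norm x powr (- 2))))"

end

theory Submission
  imports Defs "HOL-Real_Asymp.Real_Asymp"
begin

text \<open>
  Only the Laplace transform of \<open>S t\<close> enters. Write \<open>R = (norm x)\<^sup>2\<close> and let \<open>r\<close> solve
  \<open>\<phi> r = 1 / t\<close>; the minimum is \<open>r powr (d / 2)\<close> for \<open>R * r \<le> 1\<close> and the off-diagonal term
  otherwise. For the upper bounds the Gaussian kernel is dominated pointwise, on the diagonal by a
  series of exponentials in \<open>s\<close>, whose expectation is controlled by the lower scaling, and off the
  diagonal by a multiple of \<open>R powr (- d / 2) * (1 - exp (- s / R))\<close>, whose expectation is at most
  \<open>t * R powr (- d / 2) * \<phi> (1 / R)\<close>. For the lower bounds the indicator of \<open>{p / z..q / z}\<close> is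
  bounded from below by combinations of exponentials, with \<open>z = r\<close> near the diagonal and
  \<open>z = 1 / R\<close> off the diagonal. The lower scaling makes the mass above \<open>q / z\<close> negligible,
  and \<open>\<delta> < 1\<close> is needed to neglect the mass below \<open>p * R\<close> off the diagonal.
\<close>

section \<open>Elementary inequalities for exponentials and the Gaussian kernel\<close>

lemma one_minus_exp_ge:
  fixes v :: real
  assumes "0 \<le> v"
  shows "v / (1 + v) \<le> 1 - exp (- v)"
proof -
  have "exp (- v) \<le> 1 / (1 + v)"
    using exp_ge_add_one_self[of v] assms by (simp add: exp_minus field_simps)
  then show ?thesis
    using assms by (simp add: field_simps)
qed

lemma le_two_one_minus_exp:
  fixes v :: real
  assumes "0 \<le> v" "v \<le> 1"
  shows "v \<le> 2 * (1 - exp (- v))"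
proof -
  have "v / 2 \<le> v / (1 + v)"
    using assms by (intro divide_left_mono) auto
  also have "\<dots> \<le> 1 - exp (- v)"
    using assms(1) by (rule one_minus_exp_ge)
  finally show ?thesis by simp
qed

lemma one_le_two_one_minus_exp:
  fixes v :: real
  assumes "1 \<le> v"
  shows "1 \<le> 2 * (1 - exp (- v))"
proof -
  have "1 / 2 \<le> v / (1 + v)"
    using assms by (simp add: field_simps)
  also have "\<dots> \<le> 1 - exp (- v)"
    using assms by (intro one_minus_exp_ge) simp
  finally show ?thesis by simp
qed

lemma powr_mult_exp_bounded:
  fixes a :: real
  assumes "0 \<le> a"
  obtains C where "C > 0" "\<And>v. v > 0 \<Longrightarrow> v powr a * (1 + v) * exp (- v / 4) \<le> C"
proof -
  have "((\<lambda>v. v powr a * (1 + v) * exp (- v / 4)) \<longlongrightarrow> 0) at_top"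
    by real_asymp
  then have "\<forall>\<^sub>F v in at_top. v powr a * (1 + v) * exp (- v / 4) < 1"
    by (rule order_tendstoD) simp
  then obtain K0 where K0: "\<And>v. v \<ge> K0 \<Longrightarrow> v powr a * (1 + v) * exp (- v / 4) < 1"
    by (auto simp: eventually_at_top_linorder)
  define K where "K = max K0 1"
  have "v powr a * (1 + v) * exp (- v / 4) \<le> max 1 (K powr a * (1 + K))" if "v > 0" for v
  proof (cases "v \<ge> K")
    case True
    then show ?thesis using K0[of v] by (simp add: K_def)
  next
    case False
    then have "v powr a * (1 + v) * exp (- v / 4) \<le> K powr a * (1 + K) * 1"
      using that assms by (intro mult_mono powr_mono2) auto
    then show ?thesis by simp
  qed
  then show ?thesis
    by (intro that[of "max 1 (K powr a * (1 + K))"]) auto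
qed

text \<open>Scaling by \<open>v = R / s\<close> removes \<open>R\<close>. What remains is
  \<open>v powr a * exp (- v / 4) \<le> C * (1 - exp (- (1 / v)))\<close>, and the right-hand side
  is at least \<open>C / (1 + v)\<close>; this explains the factor \<open>1 + v\<close> in the
  preceding lemma.\<close>

lemma heat_kernel_le_one_minus_exp:
  fixes a :: real
  assumes "0 \<le> a"
  obtains C where "C > 0"
    "\<And>s R. s > 0 \<Longrightarrow> R > 0 \<Longrightarrow>
       s powr (- a) * exp (- R / (4 * s)) \<le> C * R powr (- a) * (1 - exp (- (s / R)))"
proof -
  obtain C where C: "C > 0" "\<And>v. v > 0 \<Longrightarrow> v powr a * (1 + v) * exp (- v / 4) \<le> C"
    using powr_mult_exp_bounded[OF assms] by blast
  have "s powr (- a) * exp (- R / (4 * s)) \<le> C * R powr (- a) * (1 - exp (- (s / R)))"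
    if "s > 0" "R > 0" for s R
  proof -
    define v where "v = R / s"
    have v: "v > 0" using that by (simp add: v_def)
    have "v powr a * exp (- v / 4) \<le> C / (1 + v)"
      using C(2)[OF v] v by (simp add: field_simps)
    also have "C / (1 + v) = C * ((1 / v) / (1 + 1 / v))"
      using v by (simp add: field_simps)
    also have "\<dots> \<le> C * (1 - exp (- (1 / v)))"
      using C(1) v by (intro mult_left_mono one_minus_exp_ge) auto
    finally have *: "v powr a * exp (- v / 4) \<le> C * (1 - exp (- (s / R)))"
      by (simp add: v_def)
    have "s powr (- a) = R powr (- a) * v powr a"
      using that by (simp add: v_def powr_divide powr_minus field_simps)
    then have "s powr (- a) * exp (- R / (4 * s)) = R powr (- a) * (v powr a * exp (- v / 4))"
      by (simp add: v_def mult.commute)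
    also have "\<dots> \<le> R powr (- a) * (C * (1 - exp (- (s / R))))"
      by (intro mult_left_mono *) simp
    finally show ?thesis by (simp add: mult_ac)
  qed
  then show ?thesis using that C(1) by blast
qed

text \<open>The term with \<open>n + 1 = \<lfloor>1 / u\<rfloor>\<close> alone dominates the left-hand side when \<open>u < 1\<close>.\<close>

lemma powr_minus_le_exp_series:
  fixes u a :: real
  assumes "u > 0" "a \<ge> 0"
  shows "ennreal (u powr (- a)) \<le>
    1 + (\<Sum>n. ennreal (exp 1 * (real n + 2) powr a) * ennreal (exp (- ((real n + 1) * u))))"
    (is "_ \<le> 1 + (\<Sum>n. ?f n)")
proof (cases "u \<ge> 1")
  case True
  then have "u powr (- a) \<le> 1 powr (- a)"
    using assms by (intro powr_mono2') auto
  then have "ennreal (u powr (- a)) \<le> 1"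
    by simp
  then show ?thesis
    by (rule order_trans) simp
next
  case False
  \<comment> \<open>As \<open>u < 1\<close>, the floor is at least 1, so the truncated subtraction
    on naturals is exact.\<close>
  define m where "m = nat \<lfloor>1 / u\<rfloor> - 1"
  have "\<lfloor>1 / u\<rfloor> \<ge> 1"
    using False assms by (simp add: le_floor_iff)
  then have m: "real m + 1 = of_int \<lfloor>1 / u\<rfloor>"
    unfolding m_def by linarith
  have "(real m + 1) * u \<le> 1"
    unfolding m using assms mult_right_mono[OF of_int_floor_le[of "1 / u"], of u] by simp
  moreover have "1 / u \<le> real m + 2"
    using m by linarith
  then have "(1 / u) powr a \<le> (real m + 2) powr a"
    using assms by (intro powr_mono2) auto
  \<comment> \<open>The exponential on the right is at least 1 because
    \<open>(m + 1) * u \<le> 1\<close>; splitting it produces the coefficient \<open>exp 1\<close>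
    of the series.\<close>
  ultimately have "1 * (1 / u) powr a \<le> exp (1 - (real m + 1) * u) * (real m + 2) powr a"
    by (intro mult_mono) auto
  also have "exp (1 - (real m + 1) * u) = exp 1 * exp (- ((real m + 1) * u))"
    by (simp flip: exp_add)
  finally have "u powr (- a) \<le> exp 1 * (real m + 2) powr a * exp (- ((real m + 1) * u))"
    using assms by (simp add: powr_divide powr_minus field_simps)
  then have "ennreal (u powr (- a)) \<le> ?f m"
    by (simp add: ennreal_leI flip: ennreal_mult)
  also have "\<dots> \<le> (\<Sum>n. ?f n)"
    using sum_le_suminf[of ?f "{m}"] by simp
  also have "\<dots> \<le> 1 + (\<Sum>n. ?f n)" by simp
  finally show ?thesis .
qed

text \<open>A stretched exponential beats every power, so the constant in the on-diagonal upper
  bound is finite for every positive \<gamma>, however small.\<close>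

lemma summable_powr_mult_exp_powr:
  fixes a c \<gamma> :: real
  assumes "c > 0" "\<gamma> > 0"
  shows "summable (\<lambda>n. (real n + 2) powr a * exp (- (c * (real n + 1) powr \<gamma>)))"
proof (rule summable_comparison_test_bigo)
  show "summable (\<lambda>n. norm (1 / real n ^ 2))"
    using inverse_power_summable[of 2, where ?'a = real] by (simp add: field_simps)
  show "(\<lambda>n. (real n + 2) powr a * exp (- (c * (real n + 1) powr \<gamma>))) \<in> O(\<lambda>n. 1 / real n ^ 2)"
    using assms by real_asymp
qed

section \<open>Estimates for a single law with prescribed Laplace transform\<close>

text \<open>To be applied with \<open>N\<close> the law of \<open>S t\<close> and
  \<open>g l = t * \<phi> l\<close>, so that time enters the estimates only through
  \<open>g\<close>.\<close>

locale laplace_law = prob_space N for N :: "real measure" +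
  fixes g :: "real \<Rightarrow> real"
  assumes sets_N [measurable_cong]: "sets N = sets borel"
    and AE_nonneg: "AE s in N. 0 \<le> s"
    and laplace: "l > 0 \<Longrightarrow> (\<integral>s. exp (- (l * s)) \<partial>N) = exp (- g l)"
begin

lemma has_bochner_integral_exp:
  assumes "l > 0"
  shows "has_bochner_integral N (\<lambda>s. exp (- (l * s))) (exp (- g l))"
proof -
  have "integrable N (\<lambda>s. exp (- (l * s)))"
    using AE_nonneg assms by (intro integrable_const_bound[of _ 1]) auto
  then show ?thesis
    using laplace[OF assms] by (simp add: has_bochner_integral_iff)
qed

lemma has_bochner_integral_one_minus_exp:
  assumes "l > 0"
  shows "has_bochner_integral N (\<lambda>s. 1 - exp (- (l * s))) (1 - exp (- g l))"
proof -
  have "has_bochner_integral N (\<lambda>_. 1 :: real) 1"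
    by (simp add: has_bochner_integral_iff prob_space)
  from has_bochner_integral_diff[OF this has_bochner_integral_exp[OF assms]] show ?thesis .
qed

lemma exponent_nonneg:
  assumes "l > 0"
  shows "0 \<le> g l"
proof -
  have "0 \<le> (\<integral>s. 1 - exp (- (l * s)) \<partial>N)"
    using AE_nonneg assms by (intro integral_nonneg_AE) auto
  then show ?thesis
    using has_bochner_integral_one_minus_exp[OF assms] by (simp add: has_bochner_integral_iff)
qed

lemma nn_integral_exp:
  assumes "l > 0"
  shows "(\<integral>\<^sup>+ s. ennreal (exp (- (l * s))) \<partial>N) = ennreal (exp (- g l))"
  using has_bochner_integral_exp[OF assms]
  by (subst nn_integral_eq_integral) (auto simp: has_bochner_integral_iff)

lemma nn_integral_one_minus_exp_le:
  assumes "l > 0"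
  shows "(\<integral>\<^sup>+ s. ennreal (1 - exp (- (l * s))) \<partial>N) \<le> ennreal (g l)"
proof -
  have "AE s in N. 0 \<le> 1 - exp (- (l * s))"
    using AE_nonneg assms by auto
  then have "(\<integral>\<^sup>+ s. ennreal (1 - exp (- (l * s))) \<partial>N) = ennreal (1 - exp (- g l))"
    using has_bochner_integral_one_minus_exp[OF assms]
    by (subst nn_integral_eq_integral) (auto simp only: has_bochner_integral_iff)
  also have "\<dots> \<le> ennreal (g l)"
    using exp_ge_add_one_self[of "- g l"] by (intro ennreal_leI) linarith
  finally show ?thesis .
qed

text \<open>The test functions \<open>f\<close> below are combinations of exponentials, whose
  expectations are known exactly. They need to lie below the indicator only on the half-line that
  carries \<open>N\<close>.\<close>

lemma le_prob_if_le_indicator: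
  assumes "has_bochner_integral N f x" "A \<in> sets borel"
    and "\<And>s. 0 \<le> s \<Longrightarrow> f s \<le> indicator A s"
  shows "x \<le> prob A"
proof -
  have "x = (\<integral>s. f s \<partial>N)"
    using assms(1) by (simp add: has_bochner_integral_iff)
  also have "\<dots> \<le> (\<integral>s. indicator A s \<partial>N)"
    using assms AE_nonneg
    by (intro integral_mono_AE)
      (auto simp: has_bochner_integral_iff sets_N emeasure_eq_measure intro!: integrable_real_indicator)
  finally show ?thesis
    using assms(2) sets_N sets_eq_imp_space_eq[OF sets_N] by simp
qed

text \<open>The exponential series is applied to \<open>u = r * s\<close> and integrated termwise;
  the exponential in the term of index \<open>n\<close> has expectation
  \<open>exp (- g ((n + 1) * r))\<close>. The growth hypothesis on \<open>g\<close>, which lower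
  scaling supplies when \<open>g r = 1\<close>, bounds the sum by a constant independent of
  \<open>r\<close>.\<close>

lemma nn_integral_powr_minus_le:
  assumes "r > 0" "a \<ge> 0" "c > 0" "\<gamma> > 0"
    and g: "\<And>n. c * (real n + 1) powr \<gamma> \<le> g ((real n + 1) * r)"
  shows "(\<integral>\<^sup>+ s\<in>{0<..}. ennreal (s powr (- a)) \<partial>N) \<le>
    ennreal ((1 + exp 1 * (\<Sum>n. (real n + 2) powr a * exp (- (c * (real n + 1) powr \<gamma>)))) * r powr a)"
proof -
  let ?f = "\<lambda>n. (real n + 2) powr a * exp (- (c * (real n + 1) powr \<gamma>))"
  have "(\<integral>\<^sup>+ s\<in>{0<..}. ennreal (s powr (- a)) \<partial>N) \<le>
    (\<integral>\<^sup>+ s. ennreal (r powr a) * (1 + (\<Sum>n. ennreal (exp 1 * (real n + 2) powr a) *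
        ennreal (exp (- ((real n + 1) * r * s))))) \<partial>N)"
  proof (rule nn_integral_mono)
    fix s :: real
    show "ennreal (s powr (- a)) * indicator {0<..} s \<le>
      ennreal (r powr a) * (1 + (\<Sum>n. ennreal (exp 1 * (real n + 2) powr a) *
        ennreal (exp (- ((real n + 1) * r * s)))))"
    proof (cases "s > 0")
      case True
      then have "s powr (- a) = r powr a * (r * s) powr (- a)"
        using assms(1) by (simp add: powr_mult powr_minus)
      then have "ennreal (s powr (- a)) = ennreal (r powr a) * ennreal ((r * s) powr (- a))"
        by (simp add: ennreal_mult)
      also have "\<dots> \<le> ennreal (r powr a) * (1 + (\<Sum>n. ennreal (exp 1 * (real n + 2) powr a) *
        ennreal (exp (- ((real n + 1) * (r * s))))))"
        using True assms by (intro mult_left_mono powr_minus_le_exp_series) auto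
      finally show ?thesis using True by (simp add: mult.assoc)
    qed simp
  qed
  also have "\<dots> = ennreal (r powr a) * (1 + (\<Sum>n. ennreal (exp 1 * (real n + 2) powr a) *
        ennreal (exp (- g ((real n + 1) * r)))))"
    using assms(1)
    by (simp add: nn_integral_cmult nn_integral_add nn_integral_suminf nn_integral_exp
        emeasure_space_1)
  also have "\<dots> \<le> ennreal (r powr a) * (1 + (\<Sum>n. ennreal (exp 1 * ?f n)))"
    using g by (intro mult_left_mono add_left_mono suminf_le)
      (auto intro!: ennreal_leI mult_left_mono simp: mult.assoc simp flip: ennreal_mult)
  also have "(\<Sum>n. ennreal (exp 1 * ?f n)) = ennreal (exp 1 * (\<Sum>n. ?f n))"
    using summable_powr_mult_exp_powr[OF assms(3,4), of a]
    by (subst suminf_ennreal2) (auto intro: summable_mult simp: suminf_mult)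
  also have "1 + ennreal (exp 1 * (\<Sum>n. ?f n)) = ennreal (1 + exp 1 * (\<Sum>n. ?f n))"
    using suminf_nonneg[OF summable_powr_mult_exp_powr[OF assms(3,4), of a]]
    by (subst ennreal_plus) auto
  also have "ennreal (r powr a) * \<dots> = ennreal ((1 + exp 1 * (\<Sum>n. ?f n)) * r powr a)"
    by (subst mult.commute) (simp flip: ennreal_mult'')
  finally show ?thesis .
qed

lemma nn_integral_heat_kernel_le:
  assumes "R > 0" "C \<ge> 0"
    and "\<And>s. s > 0 \<Longrightarrow>
       s powr (- a) * exp (- R / (4 * s)) \<le> C * R powr (- a) * (1 - exp (- (s / R)))"
  shows "(\<integral>\<^sup>+ s\<in>{0<..}. ennreal (s powr (- a) * exp (- R / (4 * s))) \<partial>N) \<le>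
    ennreal (C * R powr (- a) * g (1 / R))"
proof -
  have "(\<integral>\<^sup>+ s\<in>{0<..}. ennreal (s powr (- a) * exp (- R / (4 * s))) \<partial>N) \<le>
    (\<integral>\<^sup>+ s. ennreal (C * R powr (- a)) * ennreal (1 - exp (- (s / R))) \<partial>N)"
  proof (rule nn_integral_mono)
    fix s :: real
    show "ennreal (s powr (- a) * exp (- R / (4 * s))) * indicator {0<..} s \<le>
      ennreal (C * R powr (- a)) * ennreal (1 - exp (- (s / R)))"
      using assms(3)[of s] assms(1,2)
      by (cases "s > 0") (auto simp flip: ennreal_mult' intro: ennreal_leI)
  qed
  also have "\<dots> = ennreal (C * R powr (- a)) * (\<integral>\<^sup>+ s. ennreal (1 - exp (- (s / R))) \<partial>N)"
    by (intro nn_integral_cmult) measurable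
  also have "\<dots> \<le> ennreal (C * R powr (- a)) * ennreal (g (1 / R))"
    using assms(1) by (intro mult_left_mono nn_integral_one_minus_exp_le[of "1 / R", simplified]) auto
  finally show ?thesis
    using assms(2) by (simp add: ennreal_mult')
qed

text \<open>For the off-diagonal regime, where the mass is of order \<open>g z\<close>. The test
  function starts from \<open>1 - exp (- (z * s))\<close>, which is at most \<open>z * s\<close> and
  at most 1. Below \<open>p / z\<close> the second term absorbs \<open>z * s\<close>; above
  \<open>q / z\<close> the third term is at least 1. The assumption \<open>g z \<le> 1\<close>
  bounds \<open>1 - exp (- g z)\<close> below by \<open>g z / 2\<close>.\<close>

lemma prob_Icc_ge:
  assumes "z > 0" "p > 0" "q > 0" "g z \<le> 1"
  shows "g z / 2 - 2 * p * g (z / p) - 2 * g (z / q) \<le> prob {p / z..q / z}"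
proof -
  have pw: "(1 - exp (- (z * s))) - 2 * p * (1 - exp (- (z / p * s))) - 2 * (1 - exp (- (z / q * s)))
      \<le> indicator {p / z..q / z} s" (is "?u - ?v - ?w \<le> ?i") if "0 \<le> s" for s
  proof -
    have nn: "0 \<le> ?v" "0 \<le> ?w" "?u \<le> 1" "0 \<le> ?i"
      using assms that by auto
    consider "s < p / z" | "q / z < s" | "s \<in> {p / z..q / z}" by force
    then show ?thesis
    proof cases
      case 1
      have "?u \<le> z * s"
        using exp_ge_add_one_self[of "- (z * s)"] by linarith
      also have "z * s = p * (z / p * s)" using assms by simp
      also have "\<dots> \<le> p * (2 * (1 - exp (- (z / p * s))))"
        using 1 assms that by (intro mult_left_mono le_two_one_minus_exp) (auto simp: field_simps)
      also have "\<dots> = ?v" by (simp only: mult_ac)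
      finally show ?thesis using nn by linarith
    next
      case 2
      have "1 \<le> ?w"
        using 2 assms by (intro one_le_two_one_minus_exp) (auto simp: field_simps)
      then show ?thesis using nn by linarith
    next
      case 3
      then have "?i = 1" by simp
      then show ?thesis using nn by linarith
    qed
  qed
  have le: "1 - exp (- g l) \<le> g l" for l
    using exp_ge_add_one_self[of "- g l"] by linarith
  have "g z / 2 \<le> 1 - exp (- g z)"
    using le_two_one_minus_exp[of "g z"] exponent_nonneg[of z] assms by simp
  then have "g z / 2 - 2 * p * g (z / p) - 2 * g (z / q) \<le>
      (1 - exp (- g z)) - 2 * p * (1 - exp (- g (z / p))) - 2 * (1 - exp (- g (z / q)))"
    using assms(2) by (intro diff_mono mult_left_mono le) auto
  also have "\<dots> \<le> prob {p / z..q / z}"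
    using assms
    by (intro le_prob_if_le_indicator[OF _ _ pw] has_bochner_integral_diff
        has_bochner_integral_mult_right has_bochner_integral_one_minus_exp) auto
  finally show ?thesis .
qed

text \<open>For the regime near the diagonal, where a constant amount of mass is wanted. The test
  function starts from 1; below \<open>p / z\<close> it is cancelled by
  \<open>exp 1 * exp (- (z / p * s))\<close>, which is at least 1 there. The bound is useful once
  \<open>g (z / p)\<close> is large and \<open>g (z / q)\<close> is small.\<close>

lemma prob_Icc_ge':
  assumes "z > 0" "p > 0" "q > 0"
  shows "1 - exp (1 - g (z / p)) - 2 * g (z / q) \<le> prob {p / z..q / z}"
proof -
  have pw: "1 - exp 1 * exp (- (z / p * s)) - 2 * (1 - exp (- (z / q * s)))
      \<le> indicator {p / z..q / z} s" (is "1 - ?v - ?w \<le> ?i") if "0 \<le> s" for s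
  proof -
    have nn: "0 \<le> ?v" "0 \<le> ?w" "0 \<le> ?i"
      using assms that by auto
    consider "s < p / z" | "q / z < s" | "s \<in> {p / z..q / z}" by force
    then show ?thesis
    proof cases
      case 1
      have "1 \<le> exp (1 - z / p * s)"
        using 1 assms by (simp add: field_simps)
      also have "\<dots> = ?v"
        by (simp flip: exp_add)
      finally show ?thesis using nn by linarith
    next
      case 2
      have "1 \<le> ?w"
        using 2 assms by (intro one_le_two_one_minus_exp) (auto simp: field_simps)
      then show ?thesis using nn by linarith
    next
      case 3
      then have "?i = 1" by simp
      then show ?thesis using nn by linarith
    qed
  qed
  have one: "has_bochner_integral N (\<lambda>_. 1 :: real) 1"
    by (simp add: has_bochner_integral_iff prob_space)
  have "1 - exp (1 - g (z / p)) - 2 * g (z / q) \<le>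
      1 - exp 1 * exp (- g (z / p)) - 2 * (1 - exp (- g (z / q)))"
    using exp_ge_add_one_self[of "- g (z / q)"] by (simp flip: exp_add)
  also have "\<dots> \<le> prob {p / z..q / z}"
    using assms
    by (intro le_prob_if_le_indicator[OF _ _ pw] has_bochner_integral_diff one
        has_bochner_integral_mult_right has_bochner_integral_exp
        has_bochner_integral_one_minus_exp) auto
  finally show ?thesis .
qed

text \<open>On the interval the power factor is smallest at \<beta> and the exponential factor at
  \<alpha>, so the product of these two end values bounds the kernel from below.\<close>

lemma nn_integral_heat_kernel_ge:
  assumes "\<alpha> > 0" "R \<ge> 0" "a \<ge> 0"
  shows "ennreal (prob {\<alpha>..\<beta>} * ((4 * pi * \<beta>) powr (- a) * exp (- R / (4 * \<alpha>)))) \<le>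
    (\<integral>\<^sup>+ s\<in>{0<..}. ennreal ((4 * pi * s) powr (- a) * exp (- R / (4 * s))) \<partial>N)"
proof -
  let ?c = "(4 * pi * \<beta>) powr (- a) * exp (- R / (4 * \<alpha>))"
  have "ennreal (prob {\<alpha>..\<beta>} * ?c) = ennreal ?c * emeasure N {\<alpha>..\<beta>}"
    by (simp add: emeasure_eq_measure ennreal_mult mult.commute)
  also have "\<dots> = (\<integral>\<^sup>+ s. ennreal ?c * indicator {\<alpha>..\<beta>} s \<partial>N)"
    by (intro nn_integral_cmult_indicator[symmetric]) (simp add: sets_N)
  also have "\<dots> \<le> (\<integral>\<^sup>+ s\<in>{0<..}. ennreal ((4 * pi * s) powr (- a) * exp (- R / (4 * s))) \<partial>N)"
  proof (rule nn_integral_mono)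
    fix s :: real
    show "ennreal ?c * indicator {\<alpha>..\<beta>} s \<le>
      ennreal ((4 * pi * s) powr (- a) * exp (- R / (4 * s))) * indicator {0<..} s"
    proof (cases "s \<in> {\<alpha>..\<beta>}")
      case True
      then have s: "s > 0" "\<alpha> \<le> s" "s \<le> \<beta>" using assms by auto
      have "(4 * pi * \<beta>) powr (- a) \<le> (4 * pi * s) powr (- a)"
        using s assms by (intro powr_mono2') auto
      moreover have "R / (4 * s) \<le> R / (4 * \<alpha>)"
        using s assms by (intro divide_left_mono) auto
      then have "exp (- R / (4 * \<alpha>)) \<le> exp (- R / (4 * s))" by simp
      ultimately have "?c \<le> (4 * pi * s) powr (- a) * exp (- R / (4 * s))"
        by (intro mult_mono) auto
      then show ?thesis using True s by (simp add: ennreal_leI)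
    qed simp
  qed
  finally show ?thesis .
qed

end


section \<open>Monotonicity, growth, continuity and range of the Laplace exponent\<close>

text \<open>Convexity of \<open>exp\<close>, with \<open>- u\<close> written as the combination of
  \<open>0\<close> and \<open>- (A * u)\<close> with weights \<open>1 - 1 / A\<close> and
  \<open>1 / A\<close>.\<close>

lemma one_minus_exp_mult_le:
  fixes u A :: real
  assumes "1 \<le> A"
  shows "1 - exp (- (A * u)) \<le> A * (1 - exp (- u))"
proof -
  have "exp ((1 - 1 / A) *\<^sub>R 0 + (1 / A) *\<^sub>R (- (A * u))) \<le>
      (1 - 1 / A) * exp 0 + (1 / A) * exp (- (A * u))"
    using assms by (intro convex_onD[OF exp_convex]) auto
  then have "exp (- u) \<le> 1 - 1 / A + exp (- (A * u)) / A"
    using assms by simp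
  then have "A * exp (- u) \<le> A * (1 - 1 / A + exp (- (A * u)) / A)"
    using assms by (intro mult_left_mono) auto
  also have "\<dots> = A - 1 + exp (- (A * u))"
    using assms by (simp add: algebra_simps)
  finally show ?thesis
    by (simp add: algebra_simps)
qed

lemma levy_measure_measurable:
  assumes "levy_measure \<mu>" "f \<in> borel_measurable borel"
  shows "f \<in> borel_measurable \<mu>"
proof -
  have "f \<in> borel_measurable (restrict_space borel {0<..})"
    using assms(2) by (rule measurable_restrict_space1)
  then show ?thesis
    using assms(1) by (subst measurable_cong_sets[OF _ refl]) (auto simp: levy_measure_def)
qed

lemma space_levy_measure: "levy_measure \<mu> \<Longrightarrow> space \<mu> = {0<..}"
  using sets_eq_imp_space_eq[of \<mu> "restrict_space borel {0<..}"]
  by (auto simp: levy_measure_def space_restrict_space)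

text \<open>The Bochner integral of a nonintegrable function is 0 by default, so integrability has
  to be secured before two such integrals can be compared.\<close>

lemma integrable_one_minus_exp_levy:
  assumes "levy_measure \<mu>" "l > 0"
  shows "integrable \<mu> (\<lambda>s. 1 - exp (- l * s))"
proof (rule Bochner_Integration.integrable_bound)
  have "integrable \<mu> (\<lambda>s. min 1 s)"
    using assms(1) space_levy_measure[OF assms(1)]
    by (intro integrableI_nonneg levy_measure_measurable[OF assms(1)] AE_I2)
      (auto simp: levy_measure_def)
  then show "integrable \<mu> (\<lambda>s. (1 + l) * min 1 s)"
    by (rule integrable_mult_right)
  show "AE s in \<mu>. norm (1 - exp (- l * s)) \<le> norm ((1 + l) * min 1 s)"
  proof (rule AE_I2)
    fix s assume "s \<in> space \<mu>"
    then have s: "s > 0" using space_levy_measure[OF assms(1)] by simp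
    have "1 - exp (- l * s) \<le> l * s"
      using exp_ge_add_one_self[of "- l * s"] by linarith
    moreover have "1 - exp (- l * s) \<le> 1" by simp
    moreover have "l * s \<le> (1 + l) * s" "1 \<le> 1 + l"
      using s assms by (simp_all add: algebra_simps)
    ultimately have "1 - exp (- l * s) \<le> (1 + l) * min 1 s"
      unfolding min_def by (smt (verit) mult_cancel_left1)
    then show "norm (1 - exp (- l * s)) \<le> norm ((1 + l) * min 1 s)"
      using s assms by simp
  qed
qed (rule levy_measure_measurable[OF assms(1)], measurable)

lemma laplace_exponent_mono:
  assumes "has_laplace_exponent M S \<phi> b \<mu>" "0 < l" "l \<le> l'"
  shows "\<phi> l \<le> \<phi> l'"
proof -
  have \<mu>: "levy_measure \<mu>" and b: "b \<ge> 0"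
    and \<phi>: "\<And>l. l > 0 \<Longrightarrow> \<phi> l = b * l + (\<integral>s. (1 - exp (- l * s)) \<partial>\<mu>)"
    using assms(1) by (auto simp: has_laplace_exponent_def)
  have "(\<integral>s. (1 - exp (- l * s)) \<partial>\<mu>) \<le> (\<integral>s. (1 - exp (- l' * s)) \<partial>\<mu>)"
    using assms space_levy_measure[OF \<mu>]
    by (intro integral_mono integrable_one_minus_exp_levy[OF \<mu>]) (auto intro: mult_right_mono)
  then show ?thesis
    using assms b \<phi>[of l] \<phi>[of l'] by (simp add: add_mono mult_left_mono)
qed

lemma laplace_exponent_mult_le:
  assumes "has_laplace_exponent M S \<phi> b \<mu>" "0 < l" "1 \<le> A"
  shows "\<phi> (A * l) \<le> A * \<phi> l"
proof -
  have \<mu>: "levy_measure \<mu>"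
    and \<phi>: "\<And>l. l > 0 \<Longrightarrow> \<phi> l = b * l + (\<integral>s. (1 - exp (- l * s)) \<partial>\<mu>)"
    using assms(1) by (auto simp: has_laplace_exponent_def)
  have "(\<integral>s. (1 - exp (- (A * l) * s)) \<partial>\<mu>) \<le> (\<integral>s. A * (1 - exp (- l * s)) \<partial>\<mu>)"
    using assms one_minus_exp_mult_le[OF assms(3)]
    by (intro integral_mono integrable_mult_right integrable_one_minus_exp_levy[OF \<mu>])
      (auto simp: mult.assoc)
  also have "\<dots> = A * (\<integral>s. (1 - exp (- l * s)) \<partial>\<mu>)"
    by (rule integral_mult_right_zero)
  finally show ?thesis
    using assms \<phi>[of l] \<phi>[of "A * l"] by (simp add: algebra_simps)
qed

text \<open>Monotonicity and the growth bound \<open>\<phi> (A * l) \<le> A * \<phi> l\<close> place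
  \<open>\<phi> x\<close> between \<open>\<phi> l\<close> and \<open>x / l * \<phi> l\<close>, and
  these two agree in the limit \<open>x = l\<close>.\<close>

lemma laplace_exponent_continuous:
  assumes "has_laplace_exponent M S \<phi> b \<mu>"
  shows "continuous_on {0<..} \<phi>"
proof (rule continuous_at_imp_continuous_on, rule ballI)
  fix l :: real assume "l \<in> {0<..}"
  then have l: "l > 0" by simp
  have ev: "\<forall>\<^sub>F x in at l. x > 0"
    using l order_tendstoD(1)[OF tendsto_ident_at, of 0 l UNIV] by simp
  have "(\<phi> \<longlongrightarrow> \<phi> l) (at l)"
  proof (rule tendsto_sandwich)
    show "\<forall>\<^sub>F x in at l. min (\<phi> l) (x / l * \<phi> l) \<le> \<phi> x"
      using ev
    proof eventually_elim
      case (elim x)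
      have "x / l * \<phi> l \<le> \<phi> x" if "x < l"
        using laplace_exponent_mult_le[OF assms elim, of "l / x"] elim that l by (simp add: field_simps)
      moreover have "\<phi> l \<le> \<phi> x" if "l \<le> x"
        using laplace_exponent_mono[OF assms l that] .
      ultimately show ?case by (cases "x < l") auto
    qed
    show "\<forall>\<^sub>F x in at l. \<phi> x \<le> max (\<phi> l) (x / l * \<phi> l)"
      using ev
    proof eventually_elim
      case (elim x)
      have "\<phi> x \<le> x / l * \<phi> l" if "l \<le> x"
        using laplace_exponent_mult_le[OF assms l, of "x / l"] that l by simp
      moreover have "\<phi> x \<le> \<phi> l" if "x < l"
        using laplace_exponent_mono[OF assms elim] that by simp
      ultimately show ?case by (cases "x < l") auto
    qed
    have "((\<lambda>x. min (\<phi> l) (x / l * \<phi> l)) \<longlongrightarrow> min (\<phi> l) (l / l * \<phi> l)) (at l)"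
      using l by (intro tendsto_intros) auto
    then show "((\<lambda>x. min (\<phi> l) (x / l * \<phi> l)) \<longlongrightarrow> \<phi> l) (at l)"
      using l by simp
    have "((\<lambda>x. max (\<phi> l) (x / l * \<phi> l)) \<longlongrightarrow> max (\<phi> l) (l / l * \<phi> l)) (at l)"
      using l by (intro tendsto_intros) auto
    then show "((\<lambda>x. max (\<phi> l) (x / l * \<phi> l)) \<longlongrightarrow> \<phi> l) (at l)"
      using l by simp
  qed
  then show "isCont \<phi> l" by (simp add: isCont_def)
qed

lemma laplace_law_subordinator:
  assumes "subordinator M S" "has_laplace_exponent M S \<phi> b \<mu>" "0 \<le> t"
  shows "laplace_law (distr M borel (S t)) (\<lambda>l. t * \<phi> l)"
proof -
  interpret M: prob_space M
    using assms(1) by (simp add: subordinator_def levy_process_def)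
  have meas [measurable]: "S t \<in> borel_measurable M"
    using assms by (simp add: subordinator_def levy_process_def)
  interpret N: prob_space "distr M borel (S t)"
    by (rule M.prob_space_distr) measurable
  show ?thesis
  proof
    show "AE s in distr M borel (S t). 0 \<le> s"
      using assms by (subst AE_distr_iff) (auto simp: subordinator_def)
    show "(\<integral>s. exp (- (l * s)) \<partial>distr M borel (S t)) = exp (- (t * \<phi> l))" if "0 < l" for l
      using that assms by (subst integral_distr) (auto simp: has_laplace_exponent_def)
  qed simp
qed

text \<open>\<open>inv_into\<close> is meaningful only at attained values. By the intermediate value
  theorem it suffices to find values of \<phi> on both sides of \<open>y\<close>. Lower scaling from
  \<open>l\<^sub>L + 1\<close> gives large ones. If \<open>l\<^sub>L = 0\<close>, lower scaling from
  \<open>1 / w\<close> up to \<open>1\<close> forces \<open>\<phi> (1 / w)\<close> to be small;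
  otherwise the third assumption provides a small value.\<close>

lemma lower_scaling_attains:
  assumes "lower_scaling \<phi> \<gamma> l\<^sub>L C\<^sub>L" "has_laplace_exponent M S \<phi> b \<mu>"
    and "l\<^sub>L > 0 \<Longrightarrow> \<exists>l>0. \<phi> l \<le> y" and "y > 0"
  shows "y \<in> \<phi> ` {0<..}"
proof -
  have pos: "\<And>l. l > 0 \<Longrightarrow> \<phi> l > 0" and const: "\<gamma> > 0" "l\<^sub>L \<ge> 0" "C\<^sub>L > 0"
    and low: "\<And>l x. l > l\<^sub>L \<Longrightarrow> x \<ge> 1 \<Longrightarrow> C\<^sub>L * x powr \<gamma> \<le> \<phi> (l * x) / \<phi> l"
    using assms(1) by (auto simp: lower_scaling_def)
  have grow: "\<exists>w\<ge>1. c \<le> C\<^sub>L * w powr \<gamma>" for c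
  proof -
    have "filterlim (\<lambda>w. C\<^sub>L * w powr \<gamma>) at_top at_top"
      using const by real_asymp
    then have "\<forall>\<^sub>F w in at_top. c \<le> C\<^sub>L * w powr \<gamma>"
      by (simp add: filterlim_at_top)
    then have "\<forall>\<^sub>F w in at_top. 1 \<le> w \<and> c \<le> C\<^sub>L * w powr \<gamma>"
      using eventually_ge_at_top[of 1] by eventually_elim simp
    then show ?thesis
      by (auto simp: eventually_at_top_linorder)
  qed
  obtain l1 where l1: "l1 > 0" "\<phi> l1 \<le> y"
  proof (cases "l\<^sub>L > 0")
    case True
    then show ?thesis using assms(3) that by blast
  next
    case False
    obtain w where w: "w \<ge> 1" "\<phi> 1 / y \<le> C\<^sub>L * w powr \<gamma>"
      using grow by blast
    then have "\<phi> 1 / y \<le> \<phi> 1 / \<phi> (1 / w)"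
      using low[of "1 / w" w] False const by simp
    then have "\<phi> (1 / w) \<le> y"
      using pos[of 1] pos[of "1 / w"] w(1) assms(4) by (simp add: field_simps)
    then show ?thesis using that[of "1 / w"] w(1) by simp
  qed
  obtain w where w: "w \<ge> 1" "y / \<phi> (l\<^sub>L + 1) \<le> C\<^sub>L * w powr \<gamma>"
    using grow by blast
  then have "y / \<phi> (l\<^sub>L + 1) \<le> \<phi> ((l\<^sub>L + 1) * w) / \<phi> (l\<^sub>L + 1)"
    using low[of "l\<^sub>L + 1" w] by simp
  then have "y \<le> \<phi> ((l\<^sub>L + 1) * w)"
    using pos[of "l\<^sub>L + 1"] const by (simp add: divide_le_cancel)
  \<comment> \<open>The maximum guarantees that the right end of the interval does not lie to the
    left of \<open>l1\<close>.\<close>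
  also have "\<dots> \<le> \<phi> (max l1 ((l\<^sub>L + 1) * w))"
    using w const by (intro laplace_exponent_mono[OF assms(2)]) auto
  finally have "\<exists>l\<ge>l1. l \<le> max l1 ((l\<^sub>L + 1) * w) \<and> \<phi> l = y"
    using l1 laplace_exponent_continuous[OF assms(2)]
    by (intro IVT') (auto elim: continuous_on_subset)
  then show ?thesis using l1 by force
qed


section \<open>Choice of the interval and two-sided kernel bounds\<close>

text \<open>The condition on \<open>q\<close> makes the mass above \<open>q / z\<close> negligible.
  Of the two final conditions on \<open>p\<close>, the first serves the near-diagonal lower bound,
  and the second the off-diagonal one; the latter can be met because
  \<open>p * (1 / p) powr \<delta> = p powr (1 - \<delta>)\<close> tends to 0 with
  \<open>p\<close>.\<close>

lemma scaling_constants: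
  fixes \<gamma> \<delta> c C :: real
  assumes "\<gamma> > 0" "\<delta> < 1" "c > 0"
  obtains p q where "0 < p" "1 < q" "q powr (- \<gamma>) / c \<le> 1 / 16" "p < 1"
    "3 \<le> c * (1 / p) powr \<gamma>" "2 * p * (C * (1 / p) powr \<delta>) \<le> 1 / 8"
proof -
  have "\<forall>\<^sub>F q in at_top. q powr (- \<gamma>) / c < 1 / 16"
    by (rule order_tendstoD(2)[where y = 0]) (use assms in real_asymp, simp)
  then have "\<forall>\<^sub>F q in at_top. 1 < q \<and> q powr (- \<gamma>) / c \<le> 1 / 16"
    using eventually_gt_at_top[of 1] by eventually_elim simp
  then obtain q where q: "1 < q" "q powr (- \<gamma>) / c \<le> 1 / 16"
    by (auto simp: eventually_at_top_linorder)
  have "((\<lambda>w. 2 * (1 / w) * (C * w powr \<delta>)) \<longlongrightarrow> 0) at_top"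
  proof -
    have "((\<lambda>w. 2 * C * w powr (- (1 - \<delta>))) \<longlongrightarrow> 2 * C * 0) at_top"
      using assms by (intro tendsto_mult_left tendsto_neg_powr filterlim_ident) auto
    moreover have "\<forall>\<^sub>F w in at_top. 2 * C * w powr (- (1 - \<delta>)) = 2 * (1 / w) * (C * w powr \<delta>)"
      using eventually_gt_at_top[of 0] by eventually_elim (simp add: powr_diff)
    ultimately show ?thesis
      using Lim_transform_eventually by force
  qed
  then have "\<forall>\<^sub>F w in at_top. 2 * (1 / w) * (C * w powr \<delta>) < 1 / 8"
    by (rule order_tendstoD(2)) simp
  moreover have "filterlim (\<lambda>w. c * w powr \<gamma>) at_top at_top"
    using assms by real_asymp
  then have "\<forall>\<^sub>F w in at_top. 3 \<le> c * w powr \<gamma>"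
    by (simp add: filterlim_at_top)
  ultimately have "\<forall>\<^sub>F w in at_top.
      1 < w \<and> 3 \<le> c * w powr \<gamma> \<and> 2 * (1 / w) * (C * w powr \<delta>) \<le> 1 / 8"
    using eventually_gt_at_top[of 1] by eventually_elim simp
  then obtain w where "1 < w" "3 \<le> c * w powr \<gamma>" "2 * (1 / w) * (C * w powr \<delta>) \<le> 1 / 8"
    by (auto simp: eventually_at_top_linorder)
  with q show ?thesis
    by (intro that[of "1 / w" q]) auto
qed

text \<open>
  Here \<open>a\<close> is half the dimension, \<open>R\<close> is the squared norm of the space variable and \<open>r\<close> plays
  the role of \<open>\<phi>\<inverse> (1 / t)\<close>.
\<close>

lemma subordinated_heat_kernel_bounds:
  fixes a :: real
  assumes "a \<ge> 0" and lower: "lower_scaling \<phi> \<gamma> l\<^sub>L C\<^sub>L" and upper: "upper_scaling \<phi> \<delta> l\<^sub>U C\<^sub>U" "\<delta> < 1"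
    and mono: "\<And>l l'. 0 < l \<Longrightarrow> l \<le> l' \<Longrightarrow> \<phi> l \<le> \<phi> l'"
  obtains q c C where "q > 1" "c > 0" "C > 0"
    "\<And>N t r R m. laplace_law N (\<lambda>l. t * \<phi> l) \<Longrightarrow> t > 0 \<Longrightarrow> r > q * l\<^sub>L \<Longrightarrow> t * \<phi> r = 1 \<Longrightarrow> R \<ge> 0 \<Longrightarrow>
       (R > 0 \<Longrightarrow> 1 / R > q * l\<^sub>L \<and> 1 / R > l\<^sub>U) \<Longrightarrow>
       m = (if R = 0 then r powr a else min (r powr a) (R powr (- a) * (t * \<phi> (1 / R)))) \<Longrightarrow>
       ennreal (c * m) \<le>
         (\<integral>\<^sup>+ s\<in>{0<..}. ennreal ((4 * pi * s) powr (- a) * exp (- R / (4 * s))) \<partial>N) \<and>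
       (\<integral>\<^sup>+ s\<in>{0<..}. ennreal ((4 * pi * s) powr (- a) * exp (- R / (4 * s))) \<partial>N) \<le> ennreal (C * m)"
proof -
  have pos: "\<And>l. l > 0 \<Longrightarrow> \<phi> l > 0" and const: "\<gamma> > 0" "l\<^sub>L \<ge> 0" "C\<^sub>L > 0" "l\<^sub>U \<ge> 0" "C\<^sub>U > 0"
    and low: "\<And>l x. l > l\<^sub>L \<Longrightarrow> x \<ge> 1 \<Longrightarrow> C\<^sub>L * x powr \<gamma> \<le> \<phi> (l * x) / \<phi> l"
    and up: "\<And>l x. l > l\<^sub>U \<Longrightarrow> x \<ge> 1 \<Longrightarrow> \<phi> (l * x) / \<phi> l \<le> C\<^sub>U * x powr \<delta>"
    using lower upper by (auto simp: lower_scaling_def upper_scaling_def)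
  obtain p q where pq: "0 < p" "1 < q" "q powr (- \<gamma>) / C\<^sub>L \<le> 1 / 16" "p < 1"
    "3 \<le> C\<^sub>L * (1 / p) powr \<gamma>" "2 * p * (C\<^sub>U * (1 / p) powr \<delta>) \<le> 1 / 8"
    using scaling_constants[OF const(1) upper(2) const(3), of C\<^sub>U] by blast
  obtain K where K: "K > 0" "\<And>s R. s > 0 \<Longrightarrow> R > 0 \<Longrightarrow>
      s powr (- a) * exp (- R / (4 * s)) \<le> K * R powr (- a) * (1 - exp (- (s / R)))"
    using heat_kernel_le_one_minus_exp[OF assms(1)] by blast
  define D where "D = 1 + exp 1 * (\<Sum>n. (real n + 2) powr a * exp (- (C\<^sub>L * (real n + 1) powr \<gamma>)))"
  \<comment> \<open>The lower bound for the kernel on \<open>{p / z..q / z}\<close> with the factor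
    \<open>z powr a\<close> taken out; it applies whenever \<open>R * z \<le> 1\<close>, hence for
    both \<open>z = r\<close> and \<open>z = 1 / R\<close>.\<close>
  define d where "d = (4 * pi * q) powr (- a) * exp (- 1 / (4 * p))"
  have d: "d > 0" using pq by (simp add: d_def)
  have "ennreal (d / 4 * m) \<le>
         (\<integral>\<^sup>+ s\<in>{0<..}. ennreal ((4 * pi * s) powr (- a) * exp (- R / (4 * s))) \<partial>N) \<and>
       (\<integral>\<^sup>+ s\<in>{0<..}. ennreal ((4 * pi * s) powr (- a) * exp (- R / (4 * s))) \<partial>N) \<le> ennreal (max D K * m)"
      (is "_ \<le> ?h \<and> _")
    if law: "laplace_law N (\<lambda>l. t * \<phi> l)" and t: "t > 0" and r: "r > q * l\<^sub>L" and tr: "t * \<phi> r = 1"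
      and R: "R \<ge> 0" and Rs: "R > 0 \<Longrightarrow> 1 / R > q * l\<^sub>L \<and> 1 / R > l\<^sub>U"
      and m: "m = (if R = 0 then r powr a else min (r powr a) (R powr (- a) * (t * \<phi> (1 / R))))"
    for N t r R m
  proof -
    interpret N: laplace_law N "\<lambda>l. t * \<phi> l" by (rule law)
    have "l\<^sub>L \<le> q * l\<^sub>L" using pq const by (simp add: mult_le_cancel_right1)
    then have rL: "r > l\<^sub>L" using r by simp
    then have r0: "r > 0" using const by simp
    have m_nonneg: "m \<ge> 0"
      using pos[of "1 / R"] t R m by (auto simp: min_def)
    have h_le: "?h \<le> (\<integral>\<^sup>+ s\<in>{0<..}. ennreal (s powr (- a) * exp (- R / (4 * s))) \<partial>N)"
    proof (rule nn_integral_mono)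
      fix s :: real
      have "(4 * pi * s) powr (- a) \<le> s powr (- a)" if "s > 0"
        using that assms(1) pi_gt3 by (intro powr_mono2') auto
      then show "ennreal ((4 * pi * s) powr (- a) * exp (- R / (4 * s))) * indicator {0<..} s \<le>
          ennreal (s powr (- a) * exp (- R / (4 * s))) * indicator {0<..} s"
        by (auto split: split_indicator intro!: ennreal_leI mult_right_mono)
    qed
    also have "\<dots> \<le> (\<integral>\<^sup>+ s\<in>{0<..}. ennreal (s powr (- a)) \<partial>N)"
      using R by (intro nn_integral_mono)
        (auto split: split_indicator intro!: ennreal_leI mult_left_le)
    also have "\<dots> \<le> ennreal (D * r powr a)"
      unfolding D_def
    proof (rule N.nn_integral_powr_minus_le[OF r0 assms(1) const(3,1)])
      fix n :: nat
      have "C\<^sub>L * (real n + 1) powr \<gamma> \<le> \<phi> (r * (real n + 1)) / \<phi> r"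
        using rL by (intro low) auto
      also have "\<dots> = t * \<phi> ((real n + 1) * r)"
        using tr pos[OF r0] t by (simp add: field_simps)
      finally show "C\<^sub>L * (real n + 1) powr \<gamma> \<le> t * \<phi> ((real n + 1) * r)" .
    qed
    finally have on: "?h \<le> ennreal (D * r powr a)" .
    have off: "?h \<le> ennreal (K * (R powr (- a) * (t * \<phi> (1 / R))))" if "R > 0"
      using order_trans[OF h_le N.nn_integral_heat_kernel_le[OF that less_imp_le[OF K(1)] K(2)]] that
      by (simp add: mult.assoc)
    have upper_bound: "?h \<le> ennreal (max D K * m)"
    proof (cases "R = 0 \<or> r powr a \<le> R powr (- a) * (t * \<phi> (1 / R))")
      case True
      then have "m = r powr a" using m by auto
      then have "?h \<le> ennreal (D * m)" using on by simp
      also have "\<dots> \<le> ennreal (max D K * m)"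
        using m_nonneg by (intro ennreal_leI mult_right_mono) auto
      finally show ?thesis .
    next
      case False
      then have "m = R powr (- a) * (t * \<phi> (1 / R))" using m by auto
      moreover have "R > 0" using False R by auto
      ultimately have "?h \<le> ennreal (K * m)" using off by simp
      also have "\<dots> \<le> ennreal (max D K * m)"
        using m_nonneg by (intro ennreal_leI mult_right_mono) auto
      finally show ?thesis .
    qed
    \<comment> \<open>Lower scaling is applied from \<open>z / q\<close> up to \<open>z\<close>,
      which is why \<open>z\<close> has to exceed \<open>q * l\<^sub>L\<close> and not merely
      \<open>l\<^sub>L\<close>.\<close>
    have down: "t * \<phi> (z / q) \<le> t * \<phi> z / 16" if "z > q * l\<^sub>L" "z > 0" for z
    proof -
      have "C\<^sub>L * q powr \<gamma> \<le> \<phi> z / \<phi> (z / q)"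
        using low[of "z / q" q] that pq by (simp add: field_simps)
      then have "\<phi> (z / q) \<le> \<phi> z * (q powr (- \<gamma>) / C\<^sub>L)"
        using pos[of "z / q"] that pq const by (simp add: powr_minus field_simps)
      also have "\<dots> \<le> \<phi> z * (1 / 16)"
        using pos[OF that(2)] pq by (intro mult_left_mono) auto
      finally show ?thesis using t by simp
    qed
    have lower_bound: "ennreal (d / 4 * m) \<le> ?h"
    \<comment> \<open>It is not necessary to know which term realises the minimum: each case uses
      only that \<open>m\<close> is at most the term which that case produces.\<close>
    proof (cases "R * r \<le> 1")
      case True
      have "3 \<le> t * \<phi> (r / p)"
      proof -
        have "3 \<le> \<phi> (r * (1 / p)) / \<phi> r"
          using low[of r "1 / p"] pq rL by simp
        also have "\<dots> = t * \<phi> (r / p)"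
          using tr pos[OF r0] t by (simp add: field_simps)
        finally show ?thesis .
      qed
      then have "exp (1 - t * \<phi> (r / p)) \<le> exp (- 2)" by simp
      also have "\<dots> \<le> (1 / 4 :: real)"
      proof -
        have "2 * 2 \<le> exp 1 * exp (1 :: real)"
          using exp_ge_add_one_self[of 1] by (intro mult_mono) auto
        then show ?thesis by (simp add: exp_minus field_simps flip: exp_add)
      qed
      \<comment> \<open>Here \<open>t * \<phi> r = 1\<close>, so the mass is at least
        \<open>1 - 1 / 4 - 2 / 16\<close>, which exceeds \<open>1 / 4\<close>.\<close>
      finally have prob: "1 / 4 \<le> N.prob {p / r..q / r}"
        using N.prob_Icc_ge'[of r p q] down[OF r r0] tr pq r0 by simp
      have "R / (4 * (p / r)) = R * r / (4 * p)" using r0 by simp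
      also have "\<dots> \<le> 1 / (4 * p)" using True pq by (intro divide_right_mono) auto
      finally have e: "exp (- 1 / (4 * p)) \<le> exp (- R / (4 * (p / r)))" by simp
      have "(4 * pi * (q / r)) powr (- a) = (4 * pi * q) powr (- a) * r powr a"
        using pq r0 by (simp add: powr_divide powr_minus field_simps)
      then have "d * r powr a \<le> (4 * pi * (q / r)) powr (- a) * exp (- R / (4 * (p / r)))"
        using mult_left_mono[OF e, of "(4 * pi * q) powr (- a) * r powr a"]
        by (simp add: d_def mult_ac)
      moreover have "m \<le> r powr a" using m by auto
      ultimately have dm: "d * m \<le> (4 * pi * (q / r)) powr (- a) * exp (- R / (4 * (p / r)))"
        using d by (meson mult_left_mono less_imp_le order_trans)
      have "d / 4 * m \<le>
          N.prob {p / r..q / r} * ((4 * pi * (q / r)) powr (- a) * exp (- R / (4 * (p / r))))"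
        using mult_mono[OF prob dm] d m_nonneg by simp
      then have "ennreal (d / 4 * m) \<le> ennreal (N.prob {p / r..q / r} *
          ((4 * pi * (q / r)) powr (- a) * exp (- R / (4 * (p / r)))))"
        by (rule ennreal_leI)
      also have "\<dots> \<le> ?h"
        using pq r0 R assms(1) by (intro N.nn_integral_heat_kernel_ge) auto
      finally show ?thesis .
    next
      case False
      then have R0: "R > 0" using R by (cases "R = 0") auto
      then have zL: "1 / R > q * l\<^sub>L" and zU: "1 / R > l\<^sub>U" using Rs by auto
      let ?g = "t * \<phi> (1 / R)"
      have g0: "?g \<ge> 0" using t pos[of "1 / R"] R0 by simp
      have "1 / R \<le> r" using False R0 by (simp add: field_simps)
      then have "?g \<le> 1"
        using mono[of "1 / R" r] R0 t tr mult_left_mono[of "\<phi> (1 / R)" "\<phi> r" t] by simp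
      note prob = N.prob_Icc_ge[of "1 / R" p q, OF _ pq(1) _ this]
      have "\<phi> (1 / R / p) \<le> C\<^sub>U * (1 / p) powr \<delta> * \<phi> (1 / R)"
        using up[OF zU, of "1 / p"] pq pos[of "1 / R"] R0 by (simp add: field_simps)
      then have "2 * p * (t * \<phi> (1 / R / p)) \<le> 2 * p * (t * (C\<^sub>U * (1 / p) powr \<delta> * \<phi> (1 / R)))"
        using t pq by (intro mult_left_mono) auto
      also have "\<dots> = 2 * p * (C\<^sub>U * (1 / p) powr \<delta>) * ?g"
        by (simp only: mult_ac)
      also have "\<dots> \<le> 1 / 8 * ?g"
        using pq g0 by (intro mult_right_mono) auto
      \<comment> \<open>The fractions of \<open>?g\<close> balance as
        \<open>1 / 2 - 1 / 8 - 2 / 16 = 1 / 4\<close>.\<close>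
      finally have prob: "?g / 4 \<le> N.prob {p * R..q * R}"
        using prob down[OF zL] R0 pq by simp
      have e: "exp (- 1 / (4 * p)) = exp (- R / (4 * (p * R)))" using R0 by simp
      have pw: "(4 * pi * (q * R)) powr (- a) = (4 * pi * q) powr (- a) * R powr (- a)"
        using pq R0 by (simp add: powr_mult)
      then have *: "d * R powr (- a) = (4 * pi * (q * R)) powr (- a) * exp (- R / (4 * (p * R)))"
        unfolding d_def pw e by (simp only: mult_ac)
      have "m \<le> R powr (- a) * ?g" using m R0 by auto
      then have "d / 4 * m \<le> d / 4 * (R powr (- a) * ?g)"
        using d by (intro mult_left_mono) auto
      also have "\<dots> = ?g / 4 * (d * R powr (- a))"
        by (simp add: mult_ac)
      also have "\<dots> \<le> N.prob {p * R..q * R} * (d * R powr (- a))"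
        using d prob by (intro mult_right_mono) auto
      finally have "ennreal (d / 4 * m) \<le> ennreal (N.prob {p * R..q * R} *
          ((4 * pi * (q * R)) powr (- a) * exp (- R / (4 * (p * R)))))"
        unfolding * by (rule ennreal_leI)
      also have "\<dots> \<le> ?h"
        using pq R0 assms(1) by (intro N.nn_integral_heat_kernel_ge) auto
      finally show ?thesis .
    qed
    show ?thesis using lower_bound upper_bound by simp
  qed
  moreover have "max D K > 0" using K(1) by simp
  ultimately show ?thesis using d pq by (intro that[of q "d / 4" "max D K"]) auto
qed

section \<open>Transfer to the subordinate Brownian motion\<close>

text \<open>For \<open>y = 0\<close> the inverse is infinite, so the first assumption puts no
  restriction on \<open>u\<close>, and the conclusion reduces to \<open>0 < k\<close>. This covers
  vanishing scaling thresholds.\<close>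

lemma less_mult_inverse_ennrealD:
  assumes "ennreal u < ennreal k * inverse (ennreal y)" "0 \<le> u" "0 < k" "0 \<le> y"
  shows "u * y < k"
proof (cases "y = 0")
  case False
  then have "ennreal u < ennreal (k * inverse y)"
    using assms by (simp add: inverse_ennreal ennreal_mult)
  then have "u < k / y"
    using assms by (simp add: ennreal_less_iff divide_inverse)
  then show ?thesis using False assms by (simp add: field_simps)
qed (use assms in simp)

theorem corollary1p3:
  fixes M :: "'w measure"
    and S :: "real \<Rightarrow> 'w \<Rightarrow> real"
    and B X :: "real \<Rightarrow> 'w \<Rightarrow> real ^ 'd"
    and \<phi> :: "real \<Rightarrow> real" and b :: real and \<mu> :: "real measure"
    and \<gamma> l\<^sub>L C\<^sub>L \<delta> l\<^sub>U C\<^sub>U :: real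
  assumes "subordinator M S"
    and "has_laplace_exponent M S \<phi> b \<mu>"
    and "lower_scaling \<phi> \<gamma> l\<^sub>L C\<^sub>L"
    and "upper_scaling \<phi> \<delta> l\<^sub>U C\<^sub>U" and "\<delta> < 1"
    and "subordinate_brownian_motion M S B X"
  shows "\<exists>\<kappa>\<in>{0<..<1}. \<exists>\<eta>\<in>{0<..<1}. \<exists>\<theta>\<in>{0<..<1}.
    comparable_on
      {(t, x :: real ^ 'd). 0 < t \<and> ennreal t < ennreal \<kappa> * inverse (ennreal (\<phi> l\<^sub>L)) \<and>
         ennreal (norm x) < min (ennreal \<theta> * inverse (ennreal (sqrt l\<^sub>L)))
                                (ennreal \<eta> * inverse (ennreal (sqrt l\<^sub>U)))}
      (\<lambda>(t, x). sbm_density M S t x)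
      (\<lambda>(t, x). min (ennreal (inv_into {0<..} \<phi> (1 / t) powr (real CARD('d) / 2)))
                    (off_diagonal_bound \<phi> t x))"
proof -
  let ?a = "real CARD('d) / 2"
  have lL: "l\<^sub>L \<ge> 0" and lU: "l\<^sub>U \<ge> 0" and pos: "\<And>l. l > 0 \<Longrightarrow> \<phi> l > 0"
    using assms(3,4) by (auto simp: lower_scaling_def upper_scaling_def)
  have \<phi>0: "\<phi> 0 = 0" using assms(2) by (simp add: has_laplace_exponent_def)
  have a: "?a \<ge> 0" by simp
  obtain q c C where qcC: "q > 1" "c > 0" "C > 0"
    and bounds: "\<And>N t r R m. laplace_law N (\<lambda>l. t * \<phi> l) \<Longrightarrow> t > 0 \<Longrightarrow> r > q * l\<^sub>L \<Longrightarrow> t * \<phi> r = 1 \<Longrightarrow> R \<ge> 0 \<Longrightarrow>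
       (R > 0 \<Longrightarrow> 1 / R > q * l\<^sub>L \<and> 1 / R > l\<^sub>U) \<Longrightarrow>
       m = (if R = 0 then r powr ?a else min (r powr ?a) (R powr (- ?a) * (t * \<phi> (1 / R)))) \<Longrightarrow>
       ennreal (c * m) \<le>
         (\<integral>\<^sup>+ s\<in>{0<..}. ennreal ((4 * pi * s) powr (- ?a) * exp (- R / (4 * s))) \<partial>N) \<and>
       (\<integral>\<^sup>+ s\<in>{0<..}. ennreal ((4 * pi * s) powr (- ?a) * exp (- R / (4 * s))) \<partial>N) \<le> ennreal (C * m)"
    using subordinated_heat_kernel_bounds[OF a assms(3-5) laplace_exponent_mono[OF assms(2)]] by blast
  \<comment> \<open>The witnesses are \<open>1 / q\<close> for \<kappa>, which gives
    \<open>\<phi> (q * l\<^sub>L) < 1 / t\<close>; \<open>1 / sqrt q\<close> for \<theta>, whose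
    square gives \<open>q * l\<^sub>L < 1 / R\<close>; and \<open>1 / 2\<close> for \<eta>, where
    any number in the unit interval would give \<open>l\<^sub>U < 1 / R\<close>.\<close>
  have main: "ennreal (1 / C) * sbm_density M S t x \<le>
        min (ennreal (inv_into {0<..} \<phi> (1 / t) powr ?a)) (off_diagonal_bound \<phi> t x) \<and>
      min (ennreal (inv_into {0<..} \<phi> (1 / t) powr ?a)) (off_diagonal_bound \<phi> t x) \<le>
        ennreal (1 / c) * sbm_density M S t x"
    if t: "0 < t" and t_less: "ennreal t < ennreal (1 / q) * inverse (ennreal (\<phi> l\<^sub>L))"
      and xL: "ennreal (norm x) < ennreal (1 / sqrt q) * inverse (ennreal (sqrt l\<^sub>L))"
      and xU: "ennreal (norm x) < ennreal (1 / 2) * inverse (ennreal (sqrt l\<^sub>U))"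
    for t and x :: "real ^ 'd"
  proof -
    define r where "r = inv_into {0<..} \<phi> (1 / t)"
    define R where "R = (norm x)\<^sup>2"
    define m where "m = (if R = 0 then r powr ?a else min (r powr ?a) (R powr (- ?a) * (t * \<phi> (1 / R))))"
    have "0 \<le> \<phi> l\<^sub>L" using pos[of l\<^sub>L] \<phi>0 lL by (cases "l\<^sub>L = 0") auto
    then have "t * \<phi> l\<^sub>L < 1 / q"
      using less_mult_inverse_ennrealD[OF t_less] t qcC by simp
    then have "q * \<phi> l\<^sub>L < 1 / t" using t qcC by (simp add: field_simps)
    \<comment> \<open>The growth bound holds at positive arguments; at \<open>l\<^sub>L = 0\<close>
      both sides vanish by the convention \<open>\<phi> 0 = 0\<close>.\<close>
    moreover have "\<phi> (q * l\<^sub>L) \<le> q * \<phi> l\<^sub>L"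
      using laplace_exponent_mult_le[OF assms(2), of l\<^sub>L q] \<phi>0 lL qcC by (cases "l\<^sub>L = 0") auto
    ultimately have qL: "\<phi> (q * l\<^sub>L) < 1 / t" by simp
    \<comment> \<open>The point \<open>q * l\<^sub>L\<close> is the witness for a value of \<phi>
      below \<open>1 / t\<close>.\<close>
    then have "1 / t \<in> \<phi> ` {0<..}"
      using t qcC by (intro lower_scaling_attains[OF assms(3,2)] exI[of _ "q * l\<^sub>L"]) auto
    then have r: "r > 0" "\<phi> r = 1 / t"
      using inv_into_into[of "1 / t" \<phi> "{0<..}"] by (auto simp: r_def f_inv_into_f)
    have r_gt: "r > q * l\<^sub>L"
    proof (rule ccontr)
      assume "\<not> ?thesis"
      then have "\<phi> r \<le> \<phi> (q * l\<^sub>L)"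
        using r by (intro laplace_exponent_mono[OF assms(2)]) auto
      then show False using r qL by simp
    qed
    have R_less: "1 / R > q * l\<^sub>L \<and> 1 / R > l\<^sub>U" if "R > 0"
    proof
      have "norm x * sqrt l\<^sub>L < 1 / sqrt q"
        using less_mult_inverse_ennrealD[OF xL] qcC lL by simp
      then have "(norm x * sqrt l\<^sub>L)\<^sup>2 < (1 / sqrt q)\<^sup>2"
        using lL by (intro power_strict_mono) auto
      then have "R * l\<^sub>L < 1 / q"
        using lL qcC by (simp add: R_def power_mult_distrib power_divide)
      then show "1 / R > q * l\<^sub>L" using that qcC by (simp add: field_simps)
      have "norm x * sqrt l\<^sub>U < 1 / 2"
        using less_mult_inverse_ennrealD[OF xU] lU by simp
      then have "(norm x * sqrt l\<^sub>U)\<^sup>2 < (1 / 2)\<^sup>2"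
        using lU by (intro power_strict_mono) auto
      then have "R * l\<^sub>U < 1"
        using lU by (simp add: R_def power_mult_distrib power_divide)
      then show "1 / R > l\<^sub>U" using that by (simp add: field_simps)
    qed
    have density: "(\<integral>\<^sup>+ s\<in>{0<..}. ennreal ((4 * pi * s) powr (- ?a) * exp (- R / (4 * s)))
        \<partial>distr M borel (S t)) = sbm_density M S t x"
      by (simp add: sbm_density_def R_def)
    have "t * \<phi> r = 1" "R \<ge> 0" using r t by (simp_all add: R_def)
    note h = bounds[OF laplace_law_subordinator[OF assms(1,2) less_imp_le[OF t]] t r_gt this R_less m_def,
        unfolded density]
    \<comment> \<open>At \<open>x = 0\<close> the off-diagonal term is infinite, so the minimum is
      \<open>r powr ?a\<close>, in agreement with the branch \<open>R = 0\<close> of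
      \<open>m\<close>.\<close>
    have min_eq: "min (ennreal (r powr ?a)) (off_diagonal_bound \<phi> t x) = ennreal m"
    proof (cases "x = 0")
      case False
      then have "R = norm x powr 2" by (simp add: R_def)
      then have "norm x powr (- real CARD('d)) = R powr (- ?a)" "norm x powr (- 2) = 1 / R"
        by (simp_all only: powr_powr powr_minus_divide) simp
      then have "off_diagonal_bound \<phi> t x = ennreal (R powr (- ?a) * (t * \<phi> (1 / R)))"
        using False by (simp add: off_diagonal_bound_def mult_ac)
      moreover have "R > 0" using False by (simp add: R_def)
      moreover from this have "0 \<le> R powr (- ?a) * (t * \<phi> (1 / R))"
        using t pos[of "1 / R"] by simp
      ultimately show ?thesis by (simp add: m_def min_def)
    qed (simp add: m_def R_def off_diagonal_bound_def)
    \<comment> \<open>\<open>comparable_on\<close> bounds the minimum by multiples of the density,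
      so the estimates are solved for \<open>m\<close> and the constants are inverted.\<close>
    have "ennreal (1 / C) * sbm_density M S t x \<le> ennreal (1 / C) * ennreal (C * m)"
      by (intro mult_left_mono h[THEN conjunct2]) auto
    moreover have "ennreal (1 / c) * ennreal (c * m) \<le> ennreal (1 / c) * sbm_density M S t x"
      by (intro mult_left_mono h[THEN conjunct1]) auto
    ultimately show ?thesis
      using qcC unfolding r_def[symmetric] min_eq by (simp flip: ennreal_mult')
  qed
  have "1 / q \<in> {0<..<1}" "1 / 2 \<in> {0<..<1 :: real}" "1 / sqrt q \<in> {0<..<1}"
    using qcC by auto
  moreover have "comparable_on
      {(t, x :: real ^ 'd). 0 < t \<and> ennreal t < ennreal (1 / q) * inverse (ennreal (\<phi> l\<^sub>L)) \<and>
         ennreal (norm x) < min (ennreal (1 / sqrt q) * inverse (ennreal (sqrt l\<^sub>L)))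
                                (ennreal (1 / 2) * inverse (ennreal (sqrt l\<^sub>U)))}
      (\<lambda>(t, x). sbm_density M S t x)
      (\<lambda>(t, x). min (ennreal (inv_into {0<..} \<phi> (1 / t) powr ?a)) (off_diagonal_bound \<phi> t x))"
    unfolding comparable_on_def
    using main qcC by (intro exI[of _ "1 / C"] exI[of _ "1 / c"] conjI) auto
  ultimately show ?thesis by blast
qed

end
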